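(* Let $(B,\cdot,\circ)$ be a skew left brace with associated solution $(B,\lambda,\rho)$, and assume that the opposite skew left brace $(B,\cdot_{op},\circ)$ is a bi-skew left brace. Then (i) $\mathrm{Ker}\,\rho=\{a\in B:\rho_a=\mathrm{id}_B\}$ is an ideal of $(B,\cdot,\circ)$; (ii) the classes of the relation $\backsim$ (where $x\backsim y$ iff $\rho_x=\rho_y$) are exactly the cosets of $\mathrm{Ker}\,\rho$, so that the right retract $\mathrm{RRet}$ of $(B,\lambda,\rho)$ is the solution associated to the quotient skew left brace $(B,\cdot,\circ)/\mathrm{Ker}\,\rho$.
   Context: A skew left brace is $(B,\cdot,\circ)$ with $(B,\cdot)$ and $(B,\circ)$ groups such that $a\circ(b\cdot c)=(a\circ b)\cdot a^{-1}\cdot(a\circ c)$; $a^{-1}$ and $\bar a$ denote inverses in $(B,\cdot)$ and $(B,\circ)$. The opposite skew left brace is $(B,\cdot_{op},\circ)$ with $a\cdot_{op}b=b\cdot a$. A skew left brace $(B,\star,\circ)$ is bi-skew if $(B,\circ,\star)$ is also a skew left brace. The associated solution: $\lambda_a(b)=a^{-1}\cdot(a\circ b)$, $\rho_b(a)=\overline{\lambda_a(b)}\circ a\circ b$, $r(a,b)=(\lambda_a(b),\rho_b(a))$. An ideal is a subset $I$ that is a normal subgroup of $(B,\cdot)$ and of $(B,\circ)$ with $\lambda_a(I)\subseteq I$ for all $a$; then $a\cdot I=a\circ I$ and these cosets form the quotient skew left brace $B/I$. For a solution whose relation $\backsim$ is a congruence (which holds for right distributive solutions, i.e. $\rho_x\rho_y=\rho_{\rho_x(y)}\rho_x$,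 as is the case here), the right retract $\mathrm{RRet}$ is the induced solution on the set of $\backsim$-classes: $\lambda_{[x]}([y])=[\lambda_x(y)]$, $\rho_{[y]}([x])=[\rho_y(x)]$. *)

theory Defs
  imports "HOL-Algebra.Coset"
begin

locale skew_left_brace = A: group A + M: group M
  for A (structure) and M +
  assumes carrier_eq: "carrier M = carrier A"
    and brace_compat:
      "\<lbrakk>a \<in> carrier A; b \<in> carrier A; c \<in> carrier A\<rbrakk> \<Longrightarrow>
        a \<otimes>\<^bsub>M\<^esub> (b \<otimes>\<^bsub>A\<^esub> c)
          = (a \<otimes>\<^bsub>M\<^esub> b) \<otimes>\<^bsub>A\<^esub> inv\<^bsub>A\<^esub> a \<otimes>\<^bsub>A\<^esub> (a \<otimes>\<^bsub>M\<^esub> c)"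

definition bi_skew_left_brace ::
    "('a, 'b) monoid_scheme \<Rightarrow> ('a, 'c) monoid_scheme \<Rightarrow> bool" where
  "bi_skew_left_brace A M \<longleftrightarrow> skew_left_brace A M \<and> skew_left_brace M A"

definition opposite :: "('a, 'b) monoid_scheme \<Rightarrow> ('a, 'b) monoid_scheme" where
  "opposite A = A\<lparr>mult := \<lambda>a b. b \<otimes>\<^bsub>A\<^esub> a\<rparr>"

definition brace_lambda ::
    "('a, 'b) monoid_scheme \<Rightarrow> ('a, 'c) monoid_scheme \<Rightarrow> 'a \<Rightarrow> 'a \<Rightarrow> 'a" where
  "brace_lambda A M a b = inv\<^bsub>A\<^esub> a \<otimes>\<^bsub>A\<^esub> (a \<otimes>\<^bsub>M\<^esub> b)"

definition brace_rho ::
    "('a, 'b) monoid_scheme \<Rightarrow> ('a, 'c) monoid_scheme \<Rightarrow> 'a \<Rightarrow> 'a \<Rightarrow> 'a" where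
  "brace_rho A M b a = inv\<^bsub>M\<^esub> (brace_lambda A M a b) \<otimes>\<^bsub>M\<^esub> a \<otimes>\<^bsub>M\<^esub> b"

text \<open>
  The data \<open>(X, \<lambda>, \<rho>)\<close> of a map \<open>r (x, y) = (\<lambda>\<^sub>x y, \<rho>\<^sub>y x)\<close>; note the argument order
  \<open>rho S y x = \<rho>\<^sub>y x\<close>.  All families below are extensional on \<open>X\<close> (in both arguments), so
  that \<open>\<rho>\<^sub>x = \<rho>\<^sub>y\<close> and the equality of two solutions are plain HOL equalities, and the
  identity on \<open>X\<close> is \<open>\<lambda>x\<in>X. x\<close>.
\<close>

record 'a solution =
  points :: "'a set"
  lam :: "'a \<Rightarrow> 'a \<Rightarrow> 'a"
  rho :: "'a \<Rightarrow> 'a \<Rightarrow> 'a"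

definition assoc_solution ::
    "('a, 'b) monoid_scheme \<Rightarrow> ('a, 'c) monoid_scheme \<Rightarrow> 'a solution" where
  "assoc_solution A M =
    \<lparr>points = carrier A,
     lam = (\<lambda>a\<in>carrier A. \<lambda>b\<in>carrier A. brace_lambda A M a b),
     rho = (\<lambda>b\<in>carrier A. \<lambda>a\<in>carrier A. brace_rho A M b a)\<rparr>"

definition Ker_rho :: "'a solution \<Rightarrow> 'a set" where
  "Ker_rho S = {a \<in> points S. rho S a = (\<lambda>x\<in>points S. x)}"

definition rho_rel :: "'a solution \<Rightarrow> ('a \<times> 'a) set" where
  "rho_rel S = {(x, y). x \<in> points S \<and> y \<in> points S \<and> rho S x = rho S y}"

definition rho_rel_congruence :: "'a solution \<Rightarrow> bool" where
  "rho_rel_congruence S \<longleftrightarrow>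
     equiv (points S) (rho_rel S) \<and>
     (\<forall>(x, x') \<in> rho_rel S. \<forall>(y, y') \<in> rho_rel S.
        (lam S x y, lam S x' y') \<in> rho_rel S \<and> (rho S y x, rho S y' x') \<in> rho_rel S)"

text \<open>
  The unions are over representatives: when \<open>rho_rel S\<close> is a congruence, all the sets in a
  union are the same class.
\<close>

definition RRet :: "'a solution \<Rightarrow> 'a set solution" where
  "RRet S =
    (let Q = points S // rho_rel S in
     \<lparr>points = Q,
      lam = (\<lambda>X\<in>Q. \<lambda>Y\<in>Q. \<Union>x\<in>X. \<Union>y\<in>Y. rho_rel S `` {lam S x y}),
      rho = (\<lambda>Y\<in>Q. \<lambda>X\<in>Q. \<Union>x\<in>X. \<Union>y\<in>Y. rho_rel S `` {rho S y x})\<rparr>)"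

definition brace_ideal ::
    "'a set \<Rightarrow> ('a, 'b) monoid_scheme \<Rightarrow> ('a, 'c) monoid_scheme \<Rightarrow> bool" where
  "brace_ideal I A M \<longleftrightarrow>
     I \<lhd> A \<and> I \<lhd> M \<and> (\<forall>a \<in> carrier A. brace_lambda A M a ` I \<subseteq> I)"

text \<open>
  For an ideal \<open>I\<close> of the skew left brace \<open>(A, M)\<close>, the quotient skew left brace is the pair
  \<open>(A Mod I, M Mod I)\<close>: the two factor groups have the same carrier because
  \<open>a <#\<^bsub>A\<^esub> I = a <#\<^bsub>M\<^esub> I\<close>, and left and right cosets agree by normality.
\<close>

end

theory Submission
  imports Defs
begin

text \<open>
  Write \<open>\<mu>\<^sub>u(a) = \<bar>u \<circ> (a \<cdot> u)\<close> with the bar denoting the inverse in \<open>(B, \<circ>)\<close>. Since \<open>a \<cdot> \<lambda>\<^sub>a(b) = a \<circ> b\<close>, we have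
  \<open>\<rho>\<^sub>b(a) = \<mu>\<^sub>u(a)\<close> for \<open>u = \<lambda>\<^sub>a(b)\<close>. The map \<open>\<mu>\<close> is the \<open>\<lambda>\<close>-map of \<open>(B, \<circ>, \<cdot>\<^sub>o\<^sub>p)\<close>, so the bi-skew
  hypothesis makes it an antihomomorphism on \<open>(B, \<cdot>)\<close>, with normal kernel \<open>N\<close>. On the other hand \<open>\<rho>\<close> is an
  antihomomorphism on \<open>(B, \<circ>)\<close>, so \<open>K = Ker \<rho>\<close> is normal there and its cosets are the
  \<open>\<rho>\<close>-classes. The condition \<open>\<rho>\<^sub>k(a) = a\<close> reads \<open>\<lambda>\<^sub>a(k) = a \<circ> k \<circ> \<bar>a\<close>; since \<open>K\<close> is normal
  in \<open>(B, \<circ>)\<close>, it is stable under every \<open>\<lambda>\<^sub>a\<close> and contained in \<open>N\<close>, and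
  \<open>K = {k. \<forall>a. \<lambda>\<^sub>a(k) \<in> N}\<close>. As each \<open>\<lambda>\<^sub>a\<close> is an automorphism of \<open>(B, \<cdot>)\<close>, the normality of
  \<open>N\<close> in \<open>(B, \<cdot>)\<close> passes to \<open>K\<close>.
\<close>

context skew_left_brace
begin

section \<open>Two group laws on one carrier, and the maps \<lambda>\<close>

lemmas circ_closed [simp, intro] = M.m_closed [unfolded carrier_eq]
lemmas circ_inv_closed [simp, intro] = M.inv_closed [unfolded carrier_eq]
lemmas circ_assoc = M.m_assoc [unfolded carrier_eq]
lemmas circ_l_inv [simp] = M.l_inv [unfolded carrier_eq]
lemmas circ_r_inv [simp] = M.r_inv [unfolded carrier_eq]
lemmas circ_inv_mult = M.inv_mult_group [unfolded carrier_eq]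

lemma mult_inv_cancel [simp]:
  assumes "a \<in> carrier A" "b \<in> carrier A"
  shows "inv a \<otimes> (a \<otimes> b) = b" "a \<otimes> (inv a \<otimes> b) = b"
  using assms by (simp_all flip: A.m_assoc)

lemma circ_one_closed [simp, intro]: "\<one>\<^bsub>M\<^esub> \<in> carrier A"
  using M.one_closed carrier_eq by simp

lemma circ_l_one [simp]: "a \<in> carrier A \<Longrightarrow> \<one>\<^bsub>M\<^esub> \<otimes>\<^bsub>M\<^esub> a = a"
  and circ_r_one [simp]: "a \<in> carrier A \<Longrightarrow> a \<otimes>\<^bsub>M\<^esub> \<one>\<^bsub>M\<^esub> = a"
  using M.l_one M.r_one carrier_eq by simp_all

lemma circ_inv_cancel [simp]:
  assumes "a \<in> carrier A" "b \<in> carrier A"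
  shows "inv\<^bsub>M\<^esub> a \<otimes>\<^bsub>M\<^esub> (a \<otimes>\<^bsub>M\<^esub> b) = b" "a \<otimes>\<^bsub>M\<^esub> (inv\<^bsub>M\<^esub> a \<otimes>\<^bsub>M\<^esub> b) = b"
  using assms by (simp_all flip: circ_assoc)

lemma one_eq: "\<one>\<^bsub>M\<^esub> = \<one>"
proof -
  \<comment> \<open>At the unit of \<open>M\<close>, with \<one> in both other places, the brace law
    collapses to this equation.\<close>
  have "inv \<one>\<^bsub>M\<^esub> = \<one>"
    using brace_compat [of "\<one>\<^bsub>M\<^esub>" \<one> \<one>] by simp
  then show ?thesis
    by (metis A.inv_inv A.inv_one circ_one_closed)
qed

lemma lambda_closed [simp, intro]:
  "a \<in> carrier A \<Longrightarrow> b \<in> carrier A \<Longrightarrow> brace_lambda A M a b \<in> carrier A"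
  by (simp add: brace_lambda_def)

lemma mult_lambda:
  "a \<in> carrier A \<Longrightarrow> b \<in> carrier A \<Longrightarrow> a \<otimes> brace_lambda A M a b = a \<otimes>\<^bsub>M\<^esub> b"
  by (simp add: brace_lambda_def)

lemma lambda_mult:
  assumes "a \<in> carrier A" "b \<in> carrier A" "c \<in> carrier A"
  shows "brace_lambda A M a (b \<otimes> c) = brace_lambda A M a b \<otimes> brace_lambda A M a c"
  using assms by (simp add: brace_lambda_def brace_compat A.m_assoc)

text \<open>Writing \<open>b \<circ> c\<close> as \<open>b \<cdot> \<lambda>\<^sub>b(c)\<close>, the
  brace law gives \<open>(a \<circ> b) \<circ> c = (a \<circ> b) \<cdot>
  \<lambda>\<^sub>a(\<lambda>\<^sub>b(c))\<close>, and \<open>a \<circ> b\<close> cancels.\<close>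

lemma lambda_circ:
  assumes "a \<in> carrier A" "b \<in> carrier A" "c \<in> carrier A"
  shows "brace_lambda A M (a \<otimes>\<^bsub>M\<^esub> b) c = brace_lambda A M a (brace_lambda A M b c)"
proof -
  have "a \<otimes>\<^bsub>M\<^esub> b \<otimes>\<^bsub>M\<^esub> c = a \<otimes>\<^bsub>M\<^esub> (b \<otimes> brace_lambda A M b c)"
    using assms by (simp add: mult_lambda circ_assoc)
  then show ?thesis
    using assms brace_compat [of a b "brace_lambda A M b c"]
    by (simp add: brace_lambda_def A.m_assoc)
qed

lemma lambda_one_left [simp]: "b \<in> carrier A \<Longrightarrow> brace_lambda A M \<one> b = b"
  using circ_l_one [of b] by (simp add: brace_lambda_def one_eq)

lemma lambda_one_right [simp]: "a \<in> carrier A \<Longrightarrow> brace_lambda A M a \<one> = \<one>"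
  using circ_r_one [of a] by (simp add: brace_lambda_def one_eq)

lemma lambda_inv:
  assumes "a \<in> carrier A" "b \<in> carrier A"
  shows "brace_lambda A M a (inv b) = inv (brace_lambda A M a b)"
  using assms lambda_mult [of a "inv b" b] by (simp add: A.inv_equality)

lemma lambda_circ_inv_cancel:
  assumes "a \<in> carrier A" "b \<in> carrier A"
  shows "brace_lambda A M a (brace_lambda A M (inv\<^bsub>M\<^esub> a) b) = b"
  using assms lambda_circ [of a "inv\<^bsub>M\<^esub> a" b] by (simp add: one_eq)

text \<open>Counterpart of \<open>mult_lambda\<close> for trading a product in \<open>A\<close> for
  one in \<open>M\<close>: the second factor changes only by some \<lambda>, hence stays in any
  \<lambda>-stable set.\<close>

lemma mult_eq_circ_lambda:
  assumes "a \<in> carrier A" "b \<in> carrier A"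
  shows "a \<otimes> b = a \<otimes>\<^bsub>M\<^esub> brace_lambda A M (inv\<^bsub>M\<^esub> a) b"
  using assms mult_lambda [of a "brace_lambda A M (inv\<^bsub>M\<^esub> a) b"]
  by (simp add: lambda_circ_inv_cancel)

section \<open>The maps \<rho>, their classes, and their kernel in \<open>M\<close>\<close>

lemma rho_closed [simp, intro]:
  "a \<in> carrier A \<Longrightarrow> b \<in> carrier A \<Longrightarrow> brace_rho A M b a \<in> carrier A"
  by (simp add: brace_rho_def)

lemma lambda_circ_rho:
  assumes "a \<in> carrier A" "b \<in> carrier A"
  shows "brace_lambda A M a b \<otimes>\<^bsub>M\<^esub> brace_rho A M b a = a \<otimes>\<^bsub>M\<^esub> b"
  using assms by (simp add: brace_rho_def circ_assoc)

text \<open>With \<open>u = \<lambda>\<^sub>a(b)\<close> and \<open>v = \<rho>\<^sub>b(a)\<close>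
  one has \<open>u \<circ> v = a \<circ> b\<close> and \<open>\<lambda>\<^sub>a(b \<circ> c) = u
  \<circ> \<lambda>\<^sub>v(c)\<close>, so \<open>u\<close> cancels from the formula for the left
  side and \<open>\<rho>\<^sub>c(v)\<close> remains.\<close>

lemma rho_circ:
  assumes [simp]: "a \<in> carrier A" "b \<in> carrier A" "c \<in> carrier A"
  shows "brace_rho A M (b \<otimes>\<^bsub>M\<^esub> c) a = brace_rho A M c (brace_rho A M b a)"
proof -
  define u v where "u = brace_lambda A M a b" and "v = brace_rho A M b a"
  have [simp]: "u \<in> carrier A" "v \<in> carrier A"
    by (simp_all add: u_def v_def)
  have uv: "u \<otimes>\<^bsub>M\<^esub> v = a \<otimes>\<^bsub>M\<^esub> b"
    by (simp add: u_def v_def lambda_circ_rho)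
  have "brace_lambda A M a (b \<otimes>\<^bsub>M\<^esub> c) = brace_lambda A M a (b \<otimes> brace_lambda A M b c)"
    by (simp add: mult_lambda)
  \<comment> \<open>Replacing \<open>a \<circ> b\<close> by \<open>u \<circ> v\<close> in the index
    lets \<open>\<lambda>\<^sub>u\<close> split off next.\<close>
  also have "\<dots> = u \<otimes> brace_lambda A M (u \<otimes>\<^bsub>M\<^esub> v) c"
    by (simp add: lambda_mult uv lambda_circ flip: u_def)
  also have "\<dots> = u \<otimes>\<^bsub>M\<^esub> brace_lambda A M v c"
    by (simp add: lambda_circ mult_lambda)
  finally have "brace_rho A M (b \<otimes>\<^bsub>M\<^esub> c) a =
      inv\<^bsub>M\<^esub> (u \<otimes>\<^bsub>M\<^esub> brace_lambda A M v c) \<otimes>\<^bsub>M\<^esub> (u \<otimes>\<^bsub>M\<^esub> v) \<otimes>\<^bsub>M\<^esub> c"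
    by (simp add: brace_rho_def uv circ_assoc)
  also have "\<dots> = brace_rho A M c v"
    by (simp add: brace_rho_def circ_inv_mult circ_assoc)
  finally show ?thesis
    by (simp add: v_def)
qed

lemma rho_one [simp]: "a \<in> carrier A \<Longrightarrow> brace_rho A M \<one> a = a"
  using circ_r_one [of a] circ_l_one [of a] M.inv_one by (simp add: brace_rho_def one_eq)

text \<open>By the antihomomorphism law the left side is \<rho> of \<open>b\<close> applied after
  \<rho> of \<open>\<bar>a\<close>; there \<open>b\<close> may be replaced by \<open>a\<close>,
  which gives \<rho> at the unit.\<close>

lemma rho_circ_inv_circ:
  assumes [simp]: "a \<in> carrier A" "b \<in> carrier A" "c \<in> carrier A"
    and eq: "\<And>d. d \<in> carrier A \<Longrightarrow> brace_rho A M a d = brace_rho A M b d"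
  shows "brace_rho A M (inv\<^bsub>M\<^esub> a \<otimes>\<^bsub>M\<^esub> b) c = c"
proof -
  have "brace_rho A M (inv\<^bsub>M\<^esub> a \<otimes>\<^bsub>M\<^esub> b) c = brace_rho A M a (brace_rho A M (inv\<^bsub>M\<^esub> a) c)"
    by (simp add: rho_circ eq)
  then show ?thesis
    by (simp add: one_eq flip: rho_circ)
qed

lemma mem_Ker_rho:
  "k \<in> Ker_rho (assoc_solution A M) \<longleftrightarrow>
    k \<in> carrier A \<and> (\<forall>a \<in> carrier A. brace_rho A M k a = a)"
  by (auto simp: Ker_rho_def assoc_solution_def restrict_def fun_eq_iff)

lemma mem_rho_rel:
  "(a, b) \<in> rho_rel (assoc_solution A M) \<longleftrightarrow>
    a \<in> carrier A \<and> b \<in> carrier A \<and> (\<forall>c \<in> carrier A. brace_rho A M a c = brace_rho A M b c)"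
  by (auto simp: rho_rel_def assoc_solution_def restrict_def fun_eq_iff)

lemma rho_rel_class:
  assumes [simp]: "a \<in> carrier A"
  shows "rho_rel (assoc_solution A M) `` {a} = a <#\<^bsub>M\<^esub> Ker_rho (assoc_solution A M)"
proof (intro equalityI subsetI)
  fix b assume "b \<in> rho_rel (assoc_solution A M) `` {a}"
  then have b [simp]: "b \<in> carrier A" and "inv\<^bsub>M\<^esub> a \<otimes>\<^bsub>M\<^esub> b \<in> Ker_rho (assoc_solution A M)"
    by (auto simp: mem_rho_rel mem_Ker_rho rho_circ_inv_circ)
  moreover have "b = a \<otimes>\<^bsub>M\<^esub> (inv\<^bsub>M\<^esub> a \<otimes>\<^bsub>M\<^esub> b)"
    by simp
  ultimately show "b \<in> a <#\<^bsub>M\<^esub> Ker_rho (assoc_solution A M)"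
    unfolding l_coset_def by blast
next
  fix b assume "b \<in> a <#\<^bsub>M\<^esub> Ker_rho (assoc_solution A M)"
  then show "b \<in> rho_rel (assoc_solution A M) `` {a}"
    by (auto simp: l_coset_def mem_rho_rel mem_Ker_rho rho_circ)
qed

lemma Ker_rho_normal_circ: "Ker_rho (assoc_solution A M) \<lhd> M"
proof -
  have "subgroup (Ker_rho (assoc_solution A M)) M"
  proof
    fix k assume k: "k \<in> Ker_rho (assoc_solution A M)"
    then have [simp]: "k \<in> carrier A"
      by (simp add: mem_Ker_rho)
    have "brace_rho A M (inv\<^bsub>M\<^esub> k) a = a" if [simp]: "a \<in> carrier A" for a
      using k rho_circ [of a k "inv\<^bsub>M\<^esub> k"] by (simp add: mem_Ker_rho one_eq)
    then show "inv\<^bsub>M\<^esub> k \<in> Ker_rho (assoc_solution A M)"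
      by (simp add: mem_Ker_rho)
  qed (auto simp: mem_Ker_rho rho_circ carrier_eq one_eq)
  moreover have "x \<otimes>\<^bsub>M\<^esub> k \<otimes>\<^bsub>M\<^esub> inv\<^bsub>M\<^esub> x \<in> Ker_rho (assoc_solution A M)"
    if "x \<in> carrier M" "k \<in> Ker_rho (assoc_solution A M)" for x k
  proof -
    have x [simp]: "x \<in> carrier A" "k \<in> carrier A"
      using that by (simp_all add: mem_Ker_rho carrier_eq)
    have "brace_rho A M (x \<otimes>\<^bsub>M\<^esub> k \<otimes>\<^bsub>M\<^esub> inv\<^bsub>M\<^esub> x) a = a" if [simp]: "a \<in> carrier A" for a
      \<comment> \<open>Once \<rho> of \<open>k\<close> drops out of the middle, this instance of
        \<open>rho_circ\<close> makes the maps of \<open>x\<close> and \<open>\<bar>x\<close>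
        cancel.\<close>
      using \<open>k \<in> Ker_rho _\<close> rho_circ [of a x "inv\<^bsub>M\<^esub> x"]
      by (simp add: rho_circ mem_Ker_rho one_eq)
    then show ?thesis
      by (simp add: mem_Ker_rho)
  qed
  ultimately show ?thesis
    by (simp add: M.normal_inv_iff)
qed


subsection \<open>Quotients by ideals\<close>

context
  fixes I
  assumes ideal: "brace_ideal I A M"
begin

interpretation IA: normal I A
  using ideal by (simp add: brace_ideal_def)

interpretation IM: normal I M
  using ideal by (simp add: brace_ideal_def)

text \<open>Each inclusion rewrites one product as the other,
  \<open>a \<circ> i = a \<cdot> \<lambda>\<^sub>a(i)\<close> and its converse with \<lambda> at
  \<open>\<bar>a\<close>, and uses the \<lambda>-stability of \<open>I\<close>.\<close>

lemma ideal_l_coset_eq: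
  assumes a [simp]: "a \<in> carrier A"
  shows "a <# I = a <#\<^bsub>M\<^esub> I"
proof -
  have lam: "brace_lambda A M b i \<in> I" if "b \<in> carrier A" "i \<in> I" for b i
    using ideal that by (auto simp: brace_ideal_def)
  have "a \<otimes> i \<in> a <#\<^bsub>M\<^esub> I" "a \<otimes>\<^bsub>M\<^esub> i \<in> a <# I" if "i \<in> I" for i
  proof -
    have [simp]: "i \<in> carrier A"
      using that IA.subset by blast
    show "a \<otimes> i \<in> a <#\<^bsub>M\<^esub> I"
      using lam [of "inv\<^bsub>M\<^esub> a" i] that by (auto simp: mult_eq_circ_lambda l_coset_def)
    show "a \<otimes>\<^bsub>M\<^esub> i \<in> a <# I"
      using lam [of a i] that by (auto simp: l_coset_def simp flip: mult_lambda)
  qed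
  then show ?thesis
    by (auto simp: l_coset_def)
qed

text \<open>\<open>Mod\<close> is built from right cosets, so this is the form that identifies the
  elements of the two factor groups.\<close>

lemma ideal_r_coset_eq: "a \<in> carrier A \<Longrightarrow> I #>\<^bsub>M\<^esub> a = I #> a"
  using ideal_l_coset_eq IA.coset_eq IM.coset_eq carrier_eq by simp

lemma quotient_mult:
  assumes "a \<in> carrier A" "b \<in> carrier A"
  shows "(I #> a) \<otimes>\<^bsub>A Mod I\<^esub> (I #> b) = I #> (a \<otimes> b)"
    and "(I #> a) \<otimes>\<^bsub>M Mod I\<^esub> (I #> b) = I #> (a \<otimes>\<^bsub>M\<^esub> b)"
  using assms IA.rcos_sum [of a b] IM.rcos_sum [of a b]
  by (simp_all add: FactGroup_def carrier_eq ideal_r_coset_eq)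

lemma mem_quotient_iff: "X \<in> carrier (A Mod I) \<longleftrightarrow> (\<exists>a \<in> carrier A. X = I #> a)"
  by (auto simp: FactGroup_def RCOSETS_def)

lemma carrier_quotient_eq: "carrier (M Mod I) = carrier (A Mod I)"
  by (auto simp: FactGroup_def RCOSETS_def carrier_eq ideal_r_coset_eq)

lemma quotient_inv:
  assumes "a \<in> carrier A"
  shows "inv\<^bsub>A Mod I\<^esub> (I #> a) = I #> inv a"
    and "inv\<^bsub>M Mod I\<^esub> (I #> a) = I #> inv\<^bsub>M\<^esub> a"
proof -
  have "I #> a \<in> carrier (A Mod I)"
    using assms by (auto simp: mem_quotient_iff)
  then show "inv\<^bsub>A Mod I\<^esub> (I #> a) = I #> inv a"
    using assms by (simp add: IA.inv_FactGroup IA.rcos_inv)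
  have "I #>\<^bsub>M\<^esub> a \<in> carrier (M Mod I)"
    using \<open>I #> a \<in> _\<close> assms by (simp add: carrier_quotient_eq ideal_r_coset_eq)
  then have "inv\<^bsub>M Mod I\<^esub> (I #>\<^bsub>M\<^esub> a) = I #>\<^bsub>M\<^esub> inv\<^bsub>M\<^esub> a"
    using assms by (simp add: IM.inv_FactGroup IM.rcos_inv carrier_eq)
  then show "inv\<^bsub>M Mod I\<^esub> (I #> a) = I #> inv\<^bsub>M\<^esub> a"
    using assms by (simp add: ideal_r_coset_eq)
qed

lemma quotient_skew_left_brace: "skew_left_brace (A Mod I) (M Mod I)"
proof -
  interpret QA: group "A Mod I"
    by (rule IA.factorgroup_is_group)
  interpret QM: group "M Mod I"
    by (rule IM.factorgroup_is_group)
  show ?thesis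
  proof
    show "carrier (M Mod I) = carrier (A Mod I)"
      by (rule carrier_quotient_eq)
    fix X Y Z
    assume "X \<in> carrier (A Mod I)" "Y \<in> carrier (A Mod I)" "Z \<in> carrier (A Mod I)"
    then obtain a b c where "X = I #> a" "Y = I #> b" "Z = I #> c"
      and "a \<in> carrier A" "b \<in> carrier A" "c \<in> carrier A"
      unfolding mem_quotient_iff by blast
    then show "X \<otimes>\<^bsub>M Mod I\<^esub> (Y \<otimes>\<^bsub>A Mod I\<^esub> Z) =
        X \<otimes>\<^bsub>M Mod I\<^esub> Y \<otimes>\<^bsub>A Mod I\<^esub> inv\<^bsub>A Mod I\<^esub> X \<otimes>\<^bsub>A Mod I\<^esub> (X \<otimes>\<^bsub>M Mod I\<^esub> Z)"
      \<comment> \<open>\<open>mult_FactGroup\<close> would turn the products into set products, out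
        of reach of \<open>quotient_mult\<close>.\<close>
      by (simp add: quotient_mult quotient_inv brace_compat del: mult_FactGroup)
  qed
qed

lemma quotient_lambda:
  assumes "a \<in> carrier A" "b \<in> carrier A"
  shows "brace_lambda (A Mod I) (M Mod I) (I #> a) (I #> b) = I #> brace_lambda A M a b"
  using assms by (simp add: brace_lambda_def quotient_mult quotient_inv del: mult_FactGroup)

lemma quotient_rho:
  assumes "a \<in> carrier A" "b \<in> carrier A"
  shows "brace_rho (A Mod I) (M Mod I) (I #> b) (I #> a) = I #> brace_rho A M b a"
  using assms
  by (simp add: brace_rho_def quotient_lambda quotient_mult quotient_inv del: mult_FactGroup)

end


subsection \<open>The right retract when the kernel of rho is an ideal\<close>

context
  assumes Ker_ideal: "brace_ideal (Ker_rho (assoc_solution A M)) A M"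
begin

lemma rho_rel_class_r_coset:
  assumes "a \<in> carrier A"
  shows "rho_rel (assoc_solution A M) `` {a} = Ker_rho (assoc_solution A M) #> a"
  using assms ideal_r_coset_eq [OF Ker_ideal assms] normal.coset_eq [OF Ker_rho_normal_circ]
  by (simp add: rho_rel_class carrier_eq)

lemma equiv_rho_rel: "equiv (carrier A) (rho_rel (assoc_solution A M))"
  by (rule equivI) (auto simp: refl_on_def sym_def trans_def mem_rho_rel)

lemma rho_rel_iff:
  assumes "a \<in> carrier A" "b \<in> carrier A"
  shows "(a, b) \<in> rho_rel (assoc_solution A M) \<longleftrightarrow>
    Ker_rho (assoc_solution A M) #> a = Ker_rho (assoc_solution A M) #> b"
  using eq_equiv_class_iff [OF equiv_rho_rel assms] assms by (simp add: rho_rel_class_r_coset)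

text \<open>Through \<open>rho_rel_iff\<close> both sides become the \<lambda> of the quotient brace
  at the same two cosets.\<close>

lemma rho_rel_lambda:
  assumes "(x, x') \<in> rho_rel (assoc_solution A M)" "(y, y') \<in> rho_rel (assoc_solution A M)"
  shows "(brace_lambda A M x y, brace_lambda A M x' y') \<in> rho_rel (assoc_solution A M)"
proof -
  have [simp]: "x \<in> carrier A" "x' \<in> carrier A" "y \<in> carrier A" "y' \<in> carrier A"
    using assms by (simp_all add: mem_rho_rel)
  show ?thesis
    using assms by (simp add: rho_rel_iff flip: quotient_lambda [OF Ker_ideal])
qed

lemma rho_rel_rho:
  assumes "(x, x') \<in> rho_rel (assoc_solution A M)" "(y, y') \<in> rho_rel (assoc_solution A M)"
  shows "(brace_rho A M y x, brace_rho A M y' x') \<in> rho_rel (assoc_solution A M)"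
proof -
  have [simp]: "x \<in> carrier A" "x' \<in> carrier A" "y \<in> carrier A" "y' \<in> carrier A"
    using assms by (simp_all add: mem_rho_rel)
  show ?thesis
    using assms by (simp add: rho_rel_iff flip: quotient_rho [OF Ker_ideal])
qed

lemma rho_rel_congruence_assoc_solution: "rho_rel_congruence (assoc_solution A M)"
proof -
  have "lam (assoc_solution A M) x y = brace_lambda A M x y"
    "rho (assoc_solution A M) y x = brace_rho A M y x"
    if "x \<in> carrier A" "y \<in> carrier A" for x y
    using that by (simp_all add: assoc_solution_def)
  moreover have "points (assoc_solution A M) = carrier A"
    by (simp add: assoc_solution_def)
  moreover have "x \<in> carrier A" "y \<in> carrier A" if "(x, y) \<in> rho_rel (assoc_solution A M)" for x y
    using that by (simp_all add: mem_rho_rel)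
  ultimately show ?thesis
    using equiv_rho_rel rho_rel_lambda rho_rel_rho
    unfolding rho_rel_congruence_def case_prod_unfold
    by (simp add: Ball_def split_paired_all)
qed

lemma RRet_assoc_solution:
  "RRet (assoc_solution A M) =
    assoc_solution (A Mod Ker_rho (assoc_solution A M)) (M Mod Ker_rho (assoc_solution A M))"
proof -
  define S where "S = assoc_solution A M"
  define K where "K = Ker_rho S"
  define Q where "Q = carrier A // rho_rel S"
  have Q: "Q = carrier (A Mod K)"
    unfolding Q_def quotient_def
    by (auto simp: FactGroup_def RCOSETS_def S_def K_def rho_rel_class_r_coset)
  have pts: "points S = carrier A"
    by (simp add: S_def assoc_solution_def)
  have l: "(\<Union>x\<in>X. \<Union>y\<in>Y. rho_rel S `` {lam S x y}) = brace_lambda (A Mod K) (M Mod K) X Y"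
    and r: "(\<Union>x\<in>X. \<Union>y\<in>Y. rho_rel S `` {rho S y x}) = brace_rho (A Mod K) (M Mod K) Y X"
    if "X \<in> Q" "Y \<in> Q" for X Y
  proof -
    have "\<exists>a \<in> carrier A. X = K #> a" "\<exists>b \<in> carrier A. Y = K #> b"
      using that mem_quotient_iff [OF Ker_ideal] by (simp_all add: Q K_def S_def)
    then obtain a b where [simp]: "a \<in> carrier A" "b \<in> carrier A"
      and X: "X = K #> a" "Y = K #> b"
      by (elim bexE)
    have XY: "X = rho_rel S `` {a}" "Y = rho_rel S `` {b}"
      by (simp_all add: X S_def K_def rho_rel_class_r_coset)
    \<comment> \<open>Any member of a class represents it as a coset, so the terms of the unions in
      \<open>RRet\<close> do not depend on the representatives.\<close>
    have mem: "x \<in> carrier A" "K #> x = rho_rel S `` {c}"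
      if "x \<in> rho_rel S `` {c}" for x c
    proof -
      have cx: "(c, x) \<in> rho_rel S"
        using that by simp
      then show "x \<in> carrier A"
        by (simp add: S_def mem_rho_rel)
      then show "K #> x = rho_rel S `` {c}"
        using equiv_class_eq [OF equiv_rho_rel] cx
        by (simp add: S_def K_def flip: rho_rel_class_r_coset)
    qed
    \<comment> \<open>With nonempty index sets, the union of a constant family is its value.\<close>
    have ne: "a \<in> X" "b \<in> Y"
      by (simp_all add: XY S_def mem_rho_rel)
    have "rho_rel S `` {lam S x y} = brace_lambda (A Mod K) (M Mod K) X Y"
      "rho_rel S `` {rho S y x} = brace_rho (A Mod K) (M Mod K) Y X"
      if "x \<in> X" "y \<in> Y" for x y
    proof -
      have [simp]: "x \<in> carrier A" "y \<in> carrier A" and "X = K #> x" "Y = K #> y"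
        using mem that unfolding XY by blast+
      have "lam S x y = brace_lambda A M x y" "rho S y x = brace_rho A M y x"
        by (simp_all add: S_def assoc_solution_def)
      then show "rho_rel S `` {lam S x y} = brace_lambda (A Mod K) (M Mod K) X Y"
        "rho_rel S `` {rho S y x} = brace_rho (A Mod K) (M Mod K) Y X"
        unfolding \<open>X = K #> x\<close> \<open>Y = K #> y\<close> K_def S_def
        by (simp_all add: rho_rel_class_r_coset quotient_lambda [OF Ker_ideal]
            quotient_rho [OF Ker_ideal])
    qed
    then show "(\<Union>x\<in>X. \<Union>y\<in>Y. rho_rel S `` {lam S x y}) = brace_lambda (A Mod K) (M Mod K) X Y"
      "(\<Union>x\<in>X. \<Union>y\<in>Y. rho_rel S `` {rho S y x}) = brace_rho (A Mod K) (M Mod K) Y X"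
      using ne by auto
  qed
  \<comment> \<open>Both solutions are extensional on the same set \<open>Q\<close>, so agreement on
    \<open>Q\<close> makes them equal.\<close>
  have "RRet S = assoc_solution (A Mod K) (M Mod K)"
    unfolding RRet_def assoc_solution_def Let_def pts Q_def [symmetric] Q [symmetric]
    using l r by (simp add: restrict_def fun_eq_iff)
  then show ?thesis
    by (simp add: S_def K_def)
qed

end


subsection \<open>Normality of the kernel of rho in the additive group\<close>

text \<open>For \<open>u = \<lambda>\<^sub>a(b)\<close> the product of \<open>u\<close> and
  \<open>a\<close> in \<open>opposite A\<close> is \<open>a \<cdot> u = a \<circ> b\<close>.\<close>

lemma rho_eq_dual_lambda:
  assumes "a \<in> carrier A" "b \<in> carrier A"
  shows "brace_rho A M b a = brace_lambda M (opposite A) (brace_lambda A M a b) a"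
  using assms
  by (simp add: brace_rho_def brace_lambda_def [of M] opposite_def mult_lambda circ_assoc)

lemma Ker_rho_lambda_eq:
  assumes "k \<in> Ker_rho (assoc_solution A M)" and [simp]: "a \<in> carrier A"
  shows "brace_lambda A M a k = a \<otimes>\<^bsub>M\<^esub> k \<otimes>\<^bsub>M\<^esub> inv\<^bsub>M\<^esub> a"
proof -
  have [simp]: "k \<in> carrier A" and "brace_rho A M k a = a"
    using assms by (auto simp: mem_Ker_rho)
  then have "brace_lambda A M a k \<otimes>\<^bsub>M\<^esub> a = a \<otimes>\<^bsub>M\<^esub> k"
    using lambda_circ_rho [of a k] by simp
  then have "a \<otimes>\<^bsub>M\<^esub> k \<otimes>\<^bsub>M\<^esub> inv\<^bsub>M\<^esub> a = brace_lambda A M a k \<otimes>\<^bsub>M\<^esub> a \<otimes>\<^bsub>M\<^esub> inv\<^bsub>M\<^esub> a"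
    by simp
  then show ?thesis
    by (simp add: circ_assoc)
qed

lemma Ker_rho_lambda_closed:
  assumes "k \<in> Ker_rho (assoc_solution A M)" "a \<in> carrier A"
  shows "brace_lambda A M a k \<in> Ker_rho (assoc_solution A M)"
  using assms normal.inv_op_closed2 [OF Ker_rho_normal_circ]
  by (simp add: Ker_rho_lambda_eq carrier_eq)

lemma Ker_rho_dual_lambda:
  assumes k: "k \<in> Ker_rho (assoc_solution A M)" and [simp]: "a \<in> carrier A"
  shows "brace_lambda M (opposite A) k a = a"
proof -
  \<comment> \<open>Chosen so that
    \<open>\<lambda>\<^sub>a(l) = a \<circ> l \<circ> \<bar>a = k\<close>; then the dual \<lambda>
    of \<open>k\<close> at \<open>a\<close> is \<open>\<rho>\<^sub>l(a) = a\<close>.\<close>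
  define l where "l = inv\<^bsub>M\<^esub> a \<otimes>\<^bsub>M\<^esub> k \<otimes>\<^bsub>M\<^esub> a"
  have [simp]: "k \<in> carrier A"
    using k by (simp add: mem_Ker_rho)
  have l: "l \<in> Ker_rho (assoc_solution A M)"
    using normal.inv_op_closed1 [OF Ker_rho_normal_circ _ k, of a]
    by (simp add: l_def carrier_eq)
  then have "brace_lambda A M a l = k"
    by (simp add: Ker_rho_lambda_eq) (simp add: l_def circ_assoc)
  moreover have "brace_rho A M l a = a" "l \<in> carrier A"
    using l by (simp_all add: mem_Ker_rho)
  ultimately show ?thesis
    using rho_eq_dual_lambda [of a l] by simp
qed

lemma mem_Ker_rho_iff_dual_lambda:
  "k \<in> Ker_rho (assoc_solution A M) \<longleftrightarrow> k \<in> carrier A \<and>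
    (\<forall>a \<in> carrier A. \<forall>c \<in> carrier A. brace_lambda M (opposite A) (brace_lambda A M a k) c = c)"
    (is "_ \<longleftrightarrow> ?R")
proof
  assume "k \<in> Ker_rho (assoc_solution A M)"
  then show ?R
    using Ker_rho_lambda_closed Ker_rho_dual_lambda by (auto simp: mem_Ker_rho)
next
  assume ?R
  \<comment> \<open>The case \<open>c = a\<close> is \<open>\<rho>\<^sub>k(a) = a\<close>.\<close>
  then show "k \<in> Ker_rho (assoc_solution A M)"
    by (auto simp: mem_Ker_rho rho_eq_dual_lambda)
qed

text \<open>The product \<open>k \<cdot> l\<close> is \<open>k\<close> composed in \<open>M\<close>
  with a \<lambda>-image of \<open>l\<close>, and \<open>inv k = \<lambda>\<^sub>k(\<bar>k)\<close>;
  the kernel is \<lambda>-stable and a subgroup of \<open>M\<close>.\<close>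

lemma subgroup_Ker_rho: "subgroup (Ker_rho (assoc_solution A M)) A"
proof
  interpret K: normal "Ker_rho (assoc_solution A M)" M
    by (rule Ker_rho_normal_circ)
  show "Ker_rho (assoc_solution A M) \<subseteq> carrier A"
    by (auto simp: mem_Ker_rho)
  show "\<one> \<in> Ker_rho (assoc_solution A M)"
    by (simp add: mem_Ker_rho)
  fix k assume k: "k \<in> Ker_rho (assoc_solution A M)"
  then have kc [simp]: "k \<in> carrier A"
    by (simp add: mem_Ker_rho)
  show "k \<otimes> l \<in> Ker_rho (assoc_solution A M)" if "l \<in> Ker_rho (assoc_solution A M)" for l
    using k that Ker_rho_lambda_closed [of l "inv\<^bsub>M\<^esub> k"]
    by (simp add: mult_eq_circ_lambda mem_Ker_rho [THEN iffD1])
  have "brace_lambda A M k (inv\<^bsub>M\<^esub> k) = inv k"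
    using circ_r_inv [of k] by (simp add: brace_lambda_def one_eq)
  then show "inv k \<in> Ker_rho (assoc_solution A M)"
    using Ker_rho_lambda_closed [of "inv\<^bsub>M\<^esub> k" k] k K.m_inv_closed by force
qed

lemma brace_ideal_Ker_rho:
  assumes "skew_left_brace M (opposite A)"
  shows "brace_ideal (Ker_rho (assoc_solution A M)) A M"
proof -
  interpret D: skew_left_brace M "opposite A"
    by fact
  \<comment> \<open>The reversed order comes from \<open>opposite\<close>: the product of
    \<open>a\<close> and \<open>b\<close> there is \<open>b \<otimes> a\<close>.\<close>
  have dual_mult: "brace_lambda M (opposite A) (b \<otimes> a) c =
      brace_lambda M (opposite A) a (brace_lambda M (opposite A) b c)"
    if "a \<in> carrier A" "b \<in> carrier A" "c \<in> carrier A" for a b c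
    using that D.lambda_circ [of a b c] by (simp add: carrier_eq opposite_def)
  have dual_closed: "brace_lambda M (opposite A) a c \<in> carrier A"
    if "a \<in> carrier A" "c \<in> carrier A" for a c
    using that D.lambda_closed [of a c] by (simp add: carrier_eq)
  have dual_one: "brace_lambda M (opposite A) \<one> c = c" if "c \<in> carrier A" for c
    using that D.lambda_one_left [of c] by (simp add: carrier_eq one_eq)
  have "x \<otimes> k \<otimes> inv x \<in> Ker_rho (assoc_solution A M)"
    if [simp]: "x \<in> carrier A" and k: "k \<in> Ker_rho (assoc_solution A M)" for x k
    unfolding mem_Ker_rho_iff_dual_lambda
  proof (intro conjI ballI)
    have [simp]: "k \<in> carrier A"
      using k by (simp add: mem_Ker_rho)
    show "x \<otimes> k \<otimes> inv x \<in> carrier A"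
      by simp
    fix a c assume [simp]: "a \<in> carrier A" "c \<in> carrier A"
    \<comment> \<open>As \<open>\<lambda>\<^sub>a\<close> is an automorphism of \<open>A\<close>, it
      sends the conjugate of \<open>k\<close> by \<open>x\<close> to the conjugate of
      \<open>\<lambda>\<^sub>a(k)\<close> by \<open>y\<close>.\<close>
    define y where "y = brace_lambda A M a x"
    have [simp]: "y \<in> carrier A"
      by (simp add: y_def)
    have "brace_lambda M (opposite A) (brace_lambda A M a k) d = d" if "d \<in> carrier A" for d
      using k that unfolding mem_Ker_rho_iff_dual_lambda by simp
    moreover have "brace_lambda M (opposite A) (inv y) (brace_lambda M (opposite A) y c) = c"
      using dual_mult [of "inv y" y c] by (simp add: dual_one)
    ultimately have "brace_lambda M (opposite A) (y \<otimes> brace_lambda A M a k \<otimes> inv y) c = c"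
      by (simp add: dual_mult dual_closed)
    then show "brace_lambda M (opposite A) (brace_lambda A M a (x \<otimes> k \<otimes> inv x)) c = c"
      by (simp add: lambda_mult lambda_inv y_def)
  qed
  then have "Ker_rho (assoc_solution A M) \<lhd> A"
    using subgroup_Ker_rho by (simp add: A.normal_inv_iff)
  then show ?thesis
    using Ker_rho_normal_circ Ker_rho_lambda_closed by (auto simp: brace_ideal_def)
qed

end

theorem theorem5p15:
  fixes A :: "('a, 'b) monoid_scheme" and M :: "('a, 'c) monoid_scheme"
  assumes "skew_left_brace A M"
    and "bi_skew_left_brace (opposite A) M"
  defines "S \<equiv> assoc_solution A M"
  defines "K \<equiv> Ker_rho S"
  shows "brace_ideal K A M \<and>
    (\<forall>a \<in> carrier A. rho_rel S `` {a} = a <#\<^bsub>A\<^esub> K \<and> rho_rel S `` {a} = a <#\<^bsub>M\<^esub> K) \<and>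
    rho_rel_congruence S \<and>
    skew_left_brace (A Mod K) (M Mod K) \<and>
    RRet S = assoc_solution (A Mod K) (M Mod K)"
proof -
  interpret skew_left_brace A M
    by fact
  have ideal: "brace_ideal K A M"
    using assms(2) brace_ideal_Ker_rho by (simp add: bi_skew_left_brace_def K_def S_def)
  then have "rho_rel S `` {a} = a <#\<^bsub>A\<^esub> K \<and> rho_rel S `` {a} = a <#\<^bsub>M\<^esub> K" if "a \<in> carrier A" for a
    using that by (simp add: ideal_l_coset_eq rho_rel_class S_def K_def)
  then show ?thesis
    using ideal quotient_skew_left_brace rho_rel_congruence_assoc_solution RRet_assoc_solution
    unfolding K_def S_def by blast
qed

end
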